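(* Let $P=x^n+a_1x^{n-1}+\cdots+a_n$ be the general monic polynomial of degree $n$ in $x$, with coefficients $a=(a_1,\ldots,a_n)$ regarded as complex variables. For $1\le k\le n-1$ set $P_k:=P-\frac{xP'}{n-k}$, and set $P_n:=P'$, where $'$ denotes the derivative with respect to $x$. Then: for $k\in\{1,\ldots,n\}$, $k\neq n-1$, the polynomial $V_k:=\mathrm{Res}(P_k,P_k',x)$ is irreducible; the polynomial $\mathrm{Res}(P_{n-1},P_{n-1}',x)$ is the product of $a_n$ and of an irreducible polynomial in $a^{n-1}=(a_1,\ldots,a_{n-2},a_n)$; one sets $V_{n-1}:=\mathrm{Res}(P_{n-1},P_{n-1}',x)/a_n$.
   Context: For $1\le k\le n$, $a^k:=(a_1,\ldots,a_{k-1},a_{k+1},\ldots,a_n)$ denotes the tuple of all the coefficients except $a_k$. For $1\le k\le n-1$ the coefficient of $x^{n-k}$ in $P_k$ is $0$, so $P_k\in\mathbb{C}[a^k][x]$; likewise $P_n=P'\in\mathbb{C}[a^n][x]$. Hence $\mathrm{Res}(P_k,P_k',x)$ is a polynomial in the variables $a^k$ with complex coefficients, and irreducibility is meant for such polynomials. $\mathrm{Res}(F,G,x)$ denotes the resultant of $F$ and $G$ regarded as polynomials in $x$, i.e. the determinant of their Sylvester matrix.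
   Formalization: The formal statement assumes n ≥ 3; for n = 1 and n = 2 the claim is false (V_1 = 1 for n = 1; for n = 2, V_2 = 2 is a constant and Res(P_1,P_1',x) is a constant times a_2). *)

theory Defs
  imports
    Complex_Main
    "HOL-Library.Poly_Mapping"
    "HOL-Algebra.Ring_Divisibility"
    "Subresultants.Resultant_Prelim"
begin

text \<open>
  Polynomials with complex coefficients in variables indexed by natural numbers: a monomial is
  a finitely supported exponent function, a polynomial a finitely supported function from monomials
  to coefficients. The type provides infinitely many variables; only those with index in
  \<open>{1..n}\<close> occur below.
\<close>

type_synonym cpoly = "(nat \<Rightarrow>\<^sub>0 nat) \<Rightarrow>\<^sub>0 complex"

definition cvar :: "nat \<Rightarrow> cpoly" where
  "cvar i = Poly_Mapping.single (Poly_Mapping.single i 1) 1"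

definition cconst :: "complex \<Rightarrow> cpoly" where
  "cconst c = Poly_Mapping.single 0 c"

text \<open>The ring of complex polynomials in the variables with index in \<open>I\<close>, as a subring of
  \<^typ>\<open>cpoly\<close>; irreducibility is taken in this ring.\<close>

definition cpoly_ring :: "nat set \<Rightarrow> cpoly ring" where
  "cpoly_ring I =
    \<lparr>carrier = {p. \<forall>m \<in> Poly_Mapping.keys p. Poly_Mapping.keys m \<subseteq> I},
     monoid.mult = (*), one = 1, ring.zero = 0, add = (+)\<rparr>"

text \<open>The ring \<open>\<complex>[a\<^sup>k]\<close> of polynomials in \<open>a\<^sub>1, \<dots>, a\<^sub>n\<close> without \<open>a\<^sub>k\<close>.\<close>

abbreviation coeff_ring :: "nat \<Rightarrow> nat \<Rightarrow> cpoly ring" where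
  "coeff_ring n k \<equiv> cpoly_ring ({1..n} - {k})"

text \<open>Polynomials in \<open>x\<close> are univariate polynomials over \<^typ>\<open>cpoly\<close>.\<close>

definition general_poly :: "nat \<Rightarrow> cpoly poly" where
  "general_poly n = Polynomial.monom 1 n + (\<Sum>i = 1..n. Polynomial.monom (cvar i) (n - i))"

text \<open>\<^term>\<open>pCons 0 q\<close> is \<open>x \<cdot> q\<close>. The definition is meant for \<open>1 \<le> k \<le> n\<close>.\<close>

definition P_k :: "nat \<Rightarrow> nat \<Rightarrow> cpoly poly" where
  "P_k n k =
    (if k = n then pderiv (general_poly n)
     else general_poly n -
       Polynomial.smult (cconst (1 / of_nat (n - k))) (pCons 0 (pderiv (general_poly n))))"

definition res_deriv :: "nat \<Rightarrow> nat \<Rightarrow> cpoly" where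
  "res_deriv n k = resultant (P_k n k) (pderiv (P_k n k))"

lemma cpoly_ring_cring: "cring (cpoly_ring I)"
proof -
  have add: "p + q \<in> carrier (cpoly_ring I)"
    if "p \<in> carrier (cpoly_ring I)" "q \<in> carrier (cpoly_ring I)" for p q
    using that Poly_Mapping.keys_add[of p q] unfolding cpoly_ring_def by auto
  have mult: "p * q \<in> carrier (cpoly_ring I)"
    if p: "p \<in> carrier (cpoly_ring I)" and q: "q \<in> carrier (cpoly_ring I)" for p q
  proof -
    have "Poly_Mapping.keys m \<subseteq> I" if m: "m \<in> Poly_Mapping.keys (p * q)" for m
    proof -
      obtain a b where "m = a + b" "a \<in> Poly_Mapping.keys p" "b \<in> Poly_Mapping.keys q"
        using m keys_mult[of p q] by blast
      then show ?thesis
        using p q Poly_Mapping.keys_add[of a b] unfolding cpoly_ring_def by fastforce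
    qed
    then show ?thesis unfolding cpoly_ring_def by auto
  qed
  have uminus: "- p \<in> carrier (cpoly_ring I)" if "p \<in> carrier (cpoly_ring I)" for p
  proof -
    have "Poly_Mapping.keys (- p) = Poly_Mapping.keys p"
      by (simp add: set_eq_iff in_keys_iff)
    then show ?thesis
      using that unfolding cpoly_ring_def by simp
  qed
  have simps: "x \<oplus>\<^bsub>cpoly_ring I\<^esub> y = x + y" "x \<otimes>\<^bsub>cpoly_ring I\<^esub> y = x * y"
    "\<zero>\<^bsub>cpoly_ring I\<^esub> = 0" "\<one>\<^bsub>cpoly_ring I\<^esub> = 1" for x y
    by (simp_all add: cpoly_ring_def)
  have zero: "0 \<in> carrier (cpoly_ring I)" and one: "1 \<in> carrier (cpoly_ring I)"
    unfolding cpoly_ring_def by simp_all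
  show ?thesis
  proof (rule cringI)
    show "abelian_group (cpoly_ring I)"
    proof (rule abelian_groupI)
      fix x assume "x \<in> carrier (cpoly_ring I)"
      then show "\<exists>y\<in>carrier (cpoly_ring I). y \<oplus>\<^bsub>cpoly_ring I\<^esub> x = \<zero>\<^bsub>cpoly_ring I\<^esub>"
        by (intro bexI[of _ "- x"] uminus) (simp_all only: simps add.left_inverse)
    qed (simp_all only: simps add zero add.assoc add.left_neutral add.right_neutral
        add.commute add.left_commute)
    show "Group.comm_monoid (cpoly_ring I)"
      by (rule comm_monoidI)
        (simp_all only: simps mult one mult.assoc mult.left_neutral mult.right_neutral
          mult.commute mult.left_commute)
  qed (simp only: simps distrib_right)
qed

end

theory Submission
  imports
    Defs
    "HOL-Computational_Algebra.Field_as_Ring"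
    "HOL-Computational_Algebra.Fundamental_Theorem_Algebra"
    "HOL-Number_Theory.Cong"
    "Subresultants.Subresultant_Gcd"
begin

text \<open>
  Write \<open>F\<close> for \<open>P\<^sub>k\<close>, of degree \<open>d\<close>, and \<open>F' = x\<^bsup>r-1\<^esup> E\<close>, where \<open>r = 2\<close> for \<open>k = n - 1\<close> and \<open>r = 1\<close> otherwise.
  For \<open>r = 2\<close> the resultant of \<open>F\<close> and \<open>F'\<close> is \<open>\<plusminus>a\<^sub>n\<close> times \<open>V = Res(F, E)\<close>. Replacing \<open>F\<close> by \<open>F - (x\<^sup>r/r) E\<close>
  shows that \<open>V\<close> has degree \<open>d\<close> and a constant leading coefficient in the coefficient \<open>s\<close> of \<open>x\<^sup>r\<close>.

  Fix all coefficients except \<open>s\<close> and the constant term \<open>t\<close>. The zeros of \<open>V\<close> then lie on the curve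
  \<open>y \<mapsto> (S(y), T(y))\<close> of those pairs \<open>(s, t)\<close> for which \<open>y\<close> is a common root of \<open>F\<close> and \<open>E\<close>. A nonconstant
  factor of \<open>V\<close> has a zero over each value of \<open>t\<close>, so it vanishes on the whole curve. If the orders of
  \<open>S\<close> and \<open>T\<close> at \<open>0\<close> are coprime, the lowest terms of \<open>S\<^sup>i T\<^sup>j\<close> for \<open>i < ord T\<close> cannot cancel, so such a factor
  has degree at least \<open>ord T\<close> in \<open>s\<close>. As \<open>2 ord T > d\<close>, there cannot be two of them.
\<close>

section \<open>Evaluation of polynomials in several variables\<close>

lemma poly_mapping_sum_single:
  "(\<Sum>m\<in>Poly_Mapping.keys p. Poly_Mapping.single m (Poly_Mapping.lookup p m)) = p"
  by (rule poly_mapping_eqI)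
    (auto simp: lookup_sum lookup_single when_def in_keys_iff sum.delta' intro!: sum.neutral)

lemma cconst_0 [simp]: "cconst 0 = 0"
  and cconst_1 [simp]: "cconst 1 = 1"
  and cconst_add: "cconst (a + b) = cconst a + cconst b"
  and cconst_mult: "cconst (a * b) = cconst a * cconst b"
  by (simp_all add: cconst_def single_add mult_single)

lemma comm_ring_hom_cconst: "comm_ring_hom cconst"
  by unfold_locales (simp_all add: cconst_add cconst_mult)

interpretation cconst: comm_ring_hom cconst
  by (rule comm_ring_hom_cconst)

lemma cconst_eq_0_iff [simp]: "cconst c = 0 \<longleftrightarrow> c = 0"
  by (metis cconst_def cconst_0 lookup_single_eq lookup_zero)

lemma single_add_index: "Poly_Mapping.single (m + m') (1::complex)
    = Poly_Mapping.single m 1 * Poly_Mapping.single m' 1"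
  by (simp add: mult_single)

lemma single_one_power_cvar: "Poly_Mapping.single (Poly_Mapping.single i k) 1 = cvar i ^ k"
proof (induction k)
  case (Suc k)
  have "Poly_Mapping.single i (Suc k) = Poly_Mapping.single i 1 + Poly_Mapping.single i k"
    by (simp flip: single_add)
  then show ?case
    by (simp add: single_add_index Suc cvar_def del: single_add)
qed simp

lemma cpoly_monomial:
  "Poly_Mapping.single m c = cconst c * (\<Prod>i\<in>Poly_Mapping.keys m. cvar i ^ Poly_Mapping.lookup m i)"
proof -
  have sum: "Poly_Mapping.single (\<Sum>i\<in>A. f i) (1::complex) = (\<Prod>i\<in>A. Poly_Mapping.single (f i) 1)"
    if "finite A" for A and f :: "nat \<Rightarrow> nat \<Rightarrow>\<^sub>0 nat"
    using that by (induction A rule: finite_induct) (simp_all add: single_add_index)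
  have "Poly_Mapping.single m c = cconst c * Poly_Mapping.single m 1"
    by (simp add: cconst_def mult_single)
  also have "Poly_Mapping.single m (1::complex) =
      Poly_Mapping.single (\<Sum>i\<in>Poly_Mapping.keys m. Poly_Mapping.single i (Poly_Mapping.lookup m i)) 1"
    by (simp add: poly_mapping_sum_single)
  also have "\<dots> = (\<Prod>i\<in>Poly_Mapping.keys m. cvar i ^ Poly_Mapping.lookup m i)"
    by (simp add: sum single_one_power_cvar)
  finally show ?thesis .
qed

section \<open>Subrings of polynomials in a given set of variables\<close>

lemma cpoly_ring_carrier_iff:
  "p \<in> carrier (cpoly_ring I) \<longleftrightarrow> (\<forall>m \<in> Poly_Mapping.keys p. Poly_Mapping.keys m \<subseteq> I)"
  by (simp add: cpoly_ring_def)

lemma cpoly_ring_simps [simp]: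
  "x \<oplus>\<^bsub>cpoly_ring I\<^esub> y = x + y" "x \<otimes>\<^bsub>cpoly_ring I\<^esub> y = x * y"
  "\<zero>\<^bsub>cpoly_ring I\<^esub> = 0" "\<one>\<^bsub>cpoly_ring I\<^esub> = 1"
  by (simp_all add: cpoly_ring_def)

lemma cpoly_ring_add [intro]:
  "p \<in> carrier (cpoly_ring I) \<Longrightarrow> q \<in> carrier (cpoly_ring I) \<Longrightarrow> p + q \<in> carrier (cpoly_ring I)"
  using cring.cring_simprules(1)[OF cpoly_ring_cring, of p I q] by simp

lemma cpoly_ring_mult [intro]:
  "p \<in> carrier (cpoly_ring I) \<Longrightarrow> q \<in> carrier (cpoly_ring I) \<Longrightarrow> p * q \<in> carrier (cpoly_ring I)"
  using cring.cring_simprules(5)[OF cpoly_ring_cring, of p I q] by simp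

lemma cpoly_ring_cconst [simp, intro]: "cconst c \<in> carrier (cpoly_ring I)"
  by (auto simp: cpoly_ring_carrier_iff cconst_def)

lemma cpoly_ring_zero [simp, intro]: "0 \<in> carrier (cpoly_ring I)"
  and cpoly_ring_one [simp, intro]: "1 \<in> carrier (cpoly_ring I)"
  using cpoly_ring_cconst[of 0 I] cpoly_ring_cconst[of 1 I] by simp_all

lemma cpoly_ring_cvar [intro]: "i \<in> I \<Longrightarrow> cvar i \<in> carrier (cpoly_ring I)"
  by (auto simp: cpoly_ring_carrier_iff cvar_def)

lemma cpoly_ring_sum [intro]:
  "(\<And>x. x \<in> A \<Longrightarrow> f x \<in> carrier (cpoly_ring I)) \<Longrightarrow> sum f A \<in> carrier (cpoly_ring I)"
  by (induction A rule: infinite_finite_induct) auto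

lemma cpoly_ring_prod [intro]:
  "(\<And>x. x \<in> A \<Longrightarrow> f x \<in> carrier (cpoly_ring I)) \<Longrightarrow> prod f A \<in> carrier (cpoly_ring I)"
  by (induction A rule: infinite_finite_induct) auto

lemma cpoly_ring_det:
  assumes "A \<in> carrier_mat n n"
    and "\<And>i j. i < n \<Longrightarrow> j < n \<Longrightarrow> A $$ (i, j) \<in> carrier (cpoly_ring I)"
  shows "det A \<in> carrier (cpoly_ring I)"
proof -
  have "signof p \<in> carrier (cpoly_ring I)" for p :: "nat \<Rightarrow> nat"
    using cpoly_ring_cconst[of "signof p" I] by simp
  then show ?thesis
    unfolding det_def'[OF assms(1)]
    by (intro cpoly_ring_sum cpoly_ring_mult cpoly_ring_prod assms(2)) (auto dest: permutes_in_image)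
qed

text \<open>A polynomial is a finite sum of monomials, and \<open>cpoly_monomial\<close> splits each
  of these into a constant and variables from \<open>I\<close>. Identities between homomorphisms can
  thus be checked on generators.\<close>

lemma cpoly_ring_induct [consumes 1, case_names const var add mult]:
  assumes p: "p \<in> carrier (cpoly_ring I)"
    and const: "\<And>c. P (cconst c)"
    and var: "\<And>i. i \<in> I \<Longrightarrow> P (cvar i)"
    and add: "\<And>p q. P p \<Longrightarrow> P q \<Longrightarrow> P (p + q)"
    and mult: "\<And>p q. P p \<Longrightarrow> P q \<Longrightarrow> P (p * q)"
  shows "P p"
proof -
  have P01: "P 0" "P 1" using const[of 0] const[of 1] by simp_all
  have pow: "P (q ^ k)" if "P q" for q k
    by (induction k) (auto intro: P01 mult that)
  have prod: "P (prod f A)" if "\<And>x. x \<in> A \<Longrightarrow> P (f x)" for f :: "nat \<Rightarrow> cpoly" and A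
    using that by (induction A rule: infinite_finite_induct) (auto intro: P01 mult)
  have sum: "P (sum f A)" if "\<And>x. x \<in> A \<Longrightarrow> P (f x)" for f :: "(nat \<Rightarrow>\<^sub>0 nat) \<Rightarrow> cpoly" and A
    using that by (induction A rule: infinite_finite_induct) (auto intro: P01 add)
  have "P (\<Sum>m\<in>Poly_Mapping.keys p. Poly_Mapping.single m (Poly_Mapping.lookup p m))"
    using p by (intro sum) (auto simp: cpoly_monomial cpoly_ring_carrier_iff intro!: mult const prod pow var)
  then show ?thesis by (simp add: poly_mapping_sum_single)
qed

lemma cpoly_induct [case_names const var add mult]:
  assumes "\<And>c. P (cconst c)" "\<And>i. P (cvar i)"
    "\<And>p q. P p \<Longrightarrow> P q \<Longrightarrow> P (p + q)" "\<And>p q. P p \<Longrightarrow> P q \<Longrightarrow> P (p * q)"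
  shows "P p"
  by (rule cpoly_ring_induct[of p UNIV]) (use assms in \<open>auto simp: cpoly_ring_carrier_iff\<close>)

text \<open>The coefficient map \<open>c\<close> is a parameter because the target varies: complex
  numbers for points, univariate polynomials when one variable is kept or singled out.\<close>

definition cpoly_eval :: "(complex \<Rightarrow> 'a) \<Rightarrow> (nat \<Rightarrow> 'a) \<Rightarrow> cpoly \<Rightarrow> 'a :: comm_ring_1" where
  "cpoly_eval c f p = (\<Sum>m\<in>Poly_Mapping.keys p. c (Poly_Mapping.lookup p m) *
     (\<Prod>i\<in>Poly_Mapping.keys m. f i ^ Poly_Mapping.lookup m i))"

context
  fixes c :: "complex \<Rightarrow> 'a :: comm_ring_1" and f :: "nat \<Rightarrow> 'a"
  assumes c: "comm_ring_hom c"
begin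

interpretation c: comm_ring_hom c by (rule c)

private definition mon :: "(nat \<Rightarrow>\<^sub>0 nat) \<Rightarrow> 'a" where
  "mon m = (\<Prod>i\<in>Poly_Mapping.keys m. f i ^ Poly_Mapping.lookup m i)"

private lemma mon_superset:
  "finite A \<Longrightarrow> Poly_Mapping.keys m \<subseteq> A \<Longrightarrow> mon m = (\<Prod>i\<in>A. f i ^ Poly_Mapping.lookup m i)"
  unfolding mon_def by (rule prod.mono_neutral_left) (auto simp: in_keys_iff)

private lemma mon_add: "mon (m + m') = mon m * mon m'"
proof -
  let ?A = "Poly_Mapping.keys m \<union> Poly_Mapping.keys m'"
  have "mon (m + m') = (\<Prod>i\<in>?A. f i ^ Poly_Mapping.lookup (m + m') i)"
    by (rule mon_superset) (use Poly_Mapping.keys_add[of m m'] in auto)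
  also have "\<dots> = mon m * mon m'"
    by (simp add: mon_superset[of ?A] lookup_add power_add prod.distrib)
  finally show ?thesis .
qed

private lemma eval_superset:
  "finite A \<Longrightarrow> Poly_Mapping.keys p \<subseteq> A \<Longrightarrow>
    cpoly_eval c f p = (\<Sum>m\<in>A. c (Poly_Mapping.lookup p m) * mon m)"
  unfolding cpoly_eval_def mon_def by (rule sum.mono_neutral_left) (auto simp: in_keys_iff)

private lemma eval_add: "cpoly_eval c f (p + q) = cpoly_eval c f p + cpoly_eval c f q"
proof -
  let ?A = "Poly_Mapping.keys p \<union> Poly_Mapping.keys q"
  have "cpoly_eval c f (p + q) = (\<Sum>m\<in>?A. c (Poly_Mapping.lookup (p + q) m) * mon m)"
    by (rule eval_superset) (use Poly_Mapping.keys_add[of p q] in auto)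
  also have "\<dots> = cpoly_eval c f p + cpoly_eval c f q"
    by (simp add: eval_superset[of ?A] lookup_add c.hom_add distrib_right sum.distrib)
  finally show ?thesis .
qed

private lemma eval_single: "cpoly_eval c f (Poly_Mapping.single m a) = c a * mon m"
  by (subst eval_superset[of "{m}"]) auto

private lemma eval_0: "cpoly_eval c f 0 = 0"
  by (simp add: cpoly_eval_def)

private lemma eval_sum: "cpoly_eval c f (sum g A) = (\<Sum>x\<in>A. cpoly_eval c f (g x))"
  by (induction A rule: infinite_finite_induct) (simp_all add: eval_add eval_0)

lemma comm_ring_hom_cpoly_eval: "comm_ring_hom (cpoly_eval c f)"
proof unfold_locales
  show "cpoly_eval c f (p + q) = cpoly_eval c f p + cpoly_eval c f q" for p q
    by (rule eval_add)
  show "cpoly_eval c f (p * q) = cpoly_eval c f p * cpoly_eval c f q" for p q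
  proof -
    let ?s = "\<lambda>p m. Poly_Mapping.single m (Poly_Mapping.lookup p m) :: cpoly"
    have "p * q = (\<Sum>m\<in>Poly_Mapping.keys p. ?s p m) * (\<Sum>m\<in>Poly_Mapping.keys q. ?s q m)"
      by (simp add: poly_mapping_sum_single)
    also have "cpoly_eval c f \<dots> = (\<Sum>m\<in>Poly_Mapping.keys p. \<Sum>m'\<in>Poly_Mapping.keys q.
        (c (Poly_Mapping.lookup p m) * mon m) * (c (Poly_Mapping.lookup q m') * mon m'))"
      by (simp add: sum_product eval_sum mult_single eval_single mon_add c.hom_mult mult_ac)
    also have "\<dots> = cpoly_eval c f p * cpoly_eval c f q"
      by (simp add: cpoly_eval_def mon_def sum_product)
    finally show ?thesis .
  qed
  show "cpoly_eval c f 0 = 0"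
    by (rule eval_0)
  have "cpoly_eval c f (Poly_Mapping.single 0 1) = 1"
    unfolding eval_single by (simp add: mon_def)
  then show "cpoly_eval c f 1 = 1" by simp
qed

lemma cpoly_eval_cconst [simp]: "cpoly_eval c f (cconst a) = c a"
  by (simp add: cconst_def eval_single mon_def)

lemma cpoly_eval_cvar [simp]: "cpoly_eval c f (cvar i) = f i"
  by (simp add: cvar_def eval_single mon_def)

end

section \<open>Sylvester determinants\<close>

text \<open>Each row lists the coefficients of a shift of \<open>p\<close> or \<open>q\<close>. One
  extra factor x throughout replaces the usual exponents n-1-i and m+n-1-j by n-i and m+n-j, which
  avoids truncated subtraction.\<close>

lemma sylvester_mat_sub_index_mult:
  fixes p q :: "'a :: comm_semiring_1 poly"
  assumes "degree p \<le> m" "degree q \<le> n" "i < m + n" "j < m + n"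
  shows "sylvester_mat_sub m n p q $$ (i, j) =
    (if i < n then coeff (monom 1 (n - i) * p) (m + n - j)
     else coeff (monom 1 (m + n - i) * q) (m + n - j))"
proof (cases "i < n")
  case True
  show ?thesis
  proof (cases "i \<le> j \<and> j - i \<le> m")
    case False
    then have "coeff p (m + i - j) = 0" if "n - i \<le> m + n - j"
      using that assms True by (intro coeff_eq_0) linarith
    then show ?thesis
      using False True assms by (auto simp: sylvester_mat_sub_index coeff_monom_mult)
  qed (use assms True in \<open>auto simp: sylvester_mat_sub_index coeff_monom_mult\<close>)
next
  case False
  show ?thesis
  proof (cases "i - n \<le> j \<and> j \<le> i")
    case out: False
    then have "coeff q (i - j) = 0" if "m + n - i \<le> m + n - j"
      using that assms False by (intro coeff_eq_0) linarith
    then show ?thesis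
      using out False assms by (auto simp: sylvester_mat_sub_index coeff_monom_mult)
  qed (use assms False in \<open>auto simp: sylvester_mat_sub_index coeff_monom_mult\<close>)
qed

text \<open>These are row operations: to each shift of \<open>p\<close> a combination of shifts of
  \<open>q\<close> is added. The degree bound on \<open>u\<close> ensures that the \<open>m\<close>
  rows of \<open>q\<close> suffice, and the transformation is unitriangular.\<close>

lemma resultant_sub_add_mult:
  fixes p q u :: "'a :: comm_ring_1 poly"
  assumes p: "degree p \<le> m" and q: "degree q \<le> n" and u: "degree u + n \<le> m"
  shows "resultant_sub m n (p + u * q) q = resultant_sub m n p q"
proof -
  define S where "S = sylvester_mat_sub m n p q"
  define S' where "S' = sylvester_mat_sub m n (p + u * q) q"
  define w where "w i = monom 1 (n - i) * u" for i
  \<comment> \<open>Row \<open>i\<close> of the upper block adds the multiple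
    \<open>w i * q\<close>; column \<open>l\<close> with \<open>n \<le> l\<close> belongs to the
    shift of \<open>q\<close> by exponent \<open>m + n - l\<close>.\<close>
  define U where "U = mat (m + n) (m + n) (\<lambda>(i, l).
    if i = l then 1 else if i < n \<and> n \<le> l then coeff (w i) (m + n - l) else 0)"
  have S: "S \<in> carrier_mat (m + n) (m + n)" and U: "U \<in> carrier_mat (m + n) (m + n)"
    by (auto simp: S_def U_def)
  have "degree (u * q) \<le> m"
    using degree_mult_le[of u q] u q by linarith
  then have pq: "degree (p + u * q) \<le> m"
    using p by (rule degree_add_le[rotated])
  have w: "(\<Sum>l\<in>{n..<m+n}. coeff (w i) (m + n - l) * coeff (monom 1 (m + n - l) * q) e)
      = coeff (w i * q) e" if "i < n" for i e
  proof -
    \<comment> \<open>The exponents \<open>m + n - l\<close> available in the lower block run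
      through \<open>{1..m}\<close>, so \<open>w i\<close> must have no constant term; this holds
      because \<open>i < n\<close>.\<close>
    have w0: "coeff (w i) 0 = 0"
      using that by (simp add: w_def coeff_monom_mult)
    have "degree (w i) \<le> n + degree u"
      unfolding w_def by (rule order_trans[OF degree_mult_le]) (use degree_monom_le[of "1::'a" "n - i"] in linarith)
    then have "w i = (\<Sum>l\<le>m. monom (coeff (w i) l) l)"
      using u by (intro poly_as_sum_of_monoms'[symmetric]) linarith
    also have "\<dots> = (\<Sum>l\<in>{1..m}. monom (coeff (w i) l) l)"
      using w0 by (intro sum.mono_neutral_right) (auto simp: not_less_eq_eq)
    also have "\<dots> = (\<Sum>l\<in>{n..<m+n}. monom (coeff (w i) (m + n - l)) (m + n - l))"
      by (rule sum.reindex_bij_witness[of _ "\<lambda>l. m + n - l" "\<lambda>l. m + n - l"]) auto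
    finally have "w i * q = (\<Sum>l\<in>{n..<m+n}. monom (coeff (w i) (m + n - l)) (m + n - l)) * q"
      by (rule arg_cong)
    also have "\<dots> = (\<Sum>l\<in>{n..<m+n}. smult (coeff (w i) (m + n - l)) (monom 1 (m + n - l) * q))"
      by (simp add: sum_distrib_right smult_monom flip: mult_smult_left)
    finally have "w i * q = \<dots>" .
    then show ?thesis by (simp add: coeff_sum)
  qed
  have "U * S = S'"
  proof (rule eq_matI)
    fix i j assume "i < dim_row S'" "j < dim_col S'"
    then have i: "i < m + n" and j: "j < m + n" by (auto simp: S'_def)
    have "(U * S) $$ (i, j) = (\<Sum>l\<in>{0..<m+n}. U $$ (i, l) * S $$ (l, j))"
      using i j S U by (simp add: scalar_prod_def)
    also have "\<dots> = (\<Sum>l\<in>{0..<m+n}. (if i = l then S $$ (i, j) else 0) +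
        (if i < n \<and> n \<le> l then coeff (w i) (m + n - l) * S $$ (l, j) else 0))"
      using i by (intro sum.cong) (auto simp: U_def)
    also have "\<dots> = S $$ (i, j) +
        (\<Sum>l\<in>{0..<m+n}. if i < n \<and> n \<le> l then coeff (w i) (m + n - l) * S $$ (l, j) else 0)"
      using i by (simp add: sum.distrib)
    also have "(\<Sum>l\<in>{0..<m+n}. if i < n \<and> n \<le> l then coeff (w i) (m + n - l) * S $$ (l, j) else 0)
       = (if i < n then coeff (w i * q) (m + n - j) else 0)"
    proof (cases "i < n")
      case True
      have "(\<Sum>l\<in>{0..<m+n}. if i < n \<and> n \<le> l then coeff (w i) (m + n - l) * S $$ (l, j) else 0)
        = (\<Sum>l\<in>{n..<m+n}. coeff (w i) (m + n - l) * S $$ (l, j))"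
        using True by (intro sum.mono_neutral_cong_right) auto
      also have "\<dots> = (\<Sum>l\<in>{n..<m+n}. coeff (w i) (m + n - l) * coeff (monom 1 (m + n - l) * q) (m + n - j))"
        using j by (intro sum.cong) (auto simp: S_def sylvester_mat_sub_index_mult[OF p q])
      also have "\<dots> = coeff (w i * q) (m + n - j)"
        using True by (rule w)
      finally show ?thesis using True by simp
    qed simp
    also have "S $$ (i, j) + \<dots> = S' $$ (i, j)"
      using i j by (auto simp: S_def S'_def sylvester_mat_sub_index_mult[OF p q]
          sylvester_mat_sub_index_mult[OF pq q] w_def distrib_left mult.assoc)
    finally show "(U * S) $$ (i, j) = S' $$ (i, j)" .
  qed (auto simp: S_def S'_def U_def)
  moreover have "det U = 1"
  proof -
    have "det U = prod_list (diag_mat U)"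
      by (rule det_upper_triangular[OF _ U]) (auto simp: U_def upper_triangular_def)
    also have "\<dots> = 1"
      by (simp add: prod_list_diag_prod U_def)
    finally show ?thesis .
  qed
  ultimately show ?thesis
    using det_mult[OF U S] by (simp add: resultant_sub_def S_def S'_def)
qed

text \<open>The last column collects constant terms. Those of the shifts of x q vanish, and among
  the shifts of \<open>p\<close> only the unshifted row \<open>k\<close> contributes. Laplace
  expansion there gives the sign with exponent k + (m + k).\<close>

lemma resultant_sub_pCons_0:
  fixes p q :: "'a :: comm_ring_1 poly"
  shows "resultant_sub m (Suc k) p (pCons 0 q) = (-1) ^ m * coeff p 0 * resultant_sub m k p q"
proof -
  define A where "A = sylvester_mat_sub m (Suc k) p (pCons 0 q)"
  have A: "A \<in> carrier_mat (m + Suc k) (m + Suc k)"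
    unfolding A_def by (rule sylvester_mat_sub_carrier)
  have last: "A $$ (i, m + k) = (if i = k then coeff p 0 else 0)" if "i < m + Suc k" for i
    using that by (auto simp: A_def sylvester_mat_sub_index)
  have "mat_delete A k (m + k) = sylvester_mat_sub m k p q"
  proof (rule eq_matI)
    fix i j assume "i < dim_row (sylvester_mat_sub m k p q)" "j < dim_col (sylvester_mat_sub m k p q)"
    then have "i < m + k" "j < m + k" by auto
    then show "mat_delete A k (m + k) $$ (i, j) = sylvester_mat_sub m k p q $$ (i, j)"
      by (auto simp: mat_delete_def A_def sylvester_mat_sub_index Suc_diff_le coeff_pCons split: nat.splits)
  qed (auto simp: A_def)
  then have "cofactor A k (m + k) = (-1) ^ m * resultant_sub m k p q"
    by (simp add: cofactor_def resultant_sub_def uminus_power_if)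
  moreover have "det A = (\<Sum>i<m + Suc k. A $$ (i, m + k) * cofactor A i (m + k))"
    by (rule laplace_expansion_column[OF A]) simp
  moreover have "\<dots> = (\<Sum>i<m + Suc k. if i = k then coeff p 0 * cofactor A k (m + k) else 0)"
    by (rule sum.cong) (auto simp: last)
  moreover have "\<dots> = coeff p 0 * cofactor A k (m + k)"
    by (subst sum.delta) auto
  ultimately have "det A = coeff p 0 * ((-1) ^ m * resultant_sub m k p q)"
    by metis
  then show ?thesis
    by (simp add: resultant_sub_def A_def mult_ac)
qed

section \<open>Degrees of determinants over polynomial rings, and common roots\<close>

lemma coeff_mult_degree_le:
  fixes p q :: "'a :: comm_semiring_1 poly"
  assumes "degree p \<le> a" "degree q \<le> b"
  shows "coeff (p * q) (a + b) = coeff p a * coeff q b"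
proof (cases "degree p = a \<and> degree q = b")
  case True
  then show ?thesis using coeff_mult_degree_sum[of p q] by simp
next
  case False
  with assms have "degree p + degree q < a + b" by linarith
  then have "coeff (p * q) (a + b) = 0"
    using degree_mult_le[of p q] by (intro coeff_eq_0) linarith
  moreover have "coeff p a = 0 \<or> coeff q b = 0"
    using False assms by (auto intro!: coeff_eq_0)
  ultimately show ?thesis by auto
qed

lemma degree_coeff_prod_le:
  fixes f :: "'b \<Rightarrow> 'a :: comm_semiring_1 poly"
  assumes "finite A" "\<And>i. i \<in> A \<Longrightarrow> degree (f i) \<le> w i"
  shows "degree (prod f A) \<le> sum w A \<and> coeff (prod f A) (sum w A) = (\<Prod>i\<in>A. coeff (f i) (w i))"
  using assms
proof (induction A rule: finite_induct)
  case (insert x A)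
  then have IH: "degree (prod f A) \<le> sum w A" "coeff (prod f A) (sum w A) = (\<Prod>i\<in>A. coeff (f i) (w i))"
    and x: "degree (f x) \<le> w x" by auto
  have "degree (f x * prod f A) \<le> w x + sum w A"
    using degree_mult_le[of "f x" "prod f A"] IH(1) x by linarith
  then show ?case
    using insert.hyps by (simp add: coeff_mult_degree_le[OF x IH(1)] IH(2))
qed simp

text \<open>Every product in the Leibniz formula takes exactly one entry from each row, so row-wise
  degree bounds add up, and the top coefficient is the determinant of the row-wise top
  coefficients.\<close>

lemma degree_coeff_det_le:
  fixes M :: "'a :: comm_ring_1 poly mat"
  assumes M: "M \<in> carrier_mat n n"
    and w: "\<And>i j. i < n \<Longrightarrow> j < n \<Longrightarrow> degree (M $$ (i, j)) \<le> w i"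
  shows "degree (det M) \<le> (\<Sum>i<n. w i)"
    and "coeff (det M) (\<Sum>i<n. w i) = det (mat n n (\<lambda>(i, j). coeff (M $$ (i, j)) (w i)))"
proof -
  let ?P = "{p. p permutes {0..<n}}"
  have prod: "degree (\<Prod>i=0..<n. M $$ (i, p i)) \<le> (\<Sum>i<n. w i)"
    "coeff (\<Prod>i=0..<n. M $$ (i, p i)) (\<Sum>i<n. w i) = (\<Prod>i=0..<n. coeff (M $$ (i, p i)) (w i))"
    if "p \<in> ?P" for p
    using degree_coeff_prod_le[of "{0..<n}" "\<lambda>i. M $$ (i, p i)" w] w that
    by (auto simp: permutes_in_image atLeast0LessThan)
  have sign: "signof p * q = smult (signof p) q" for p :: "nat \<Rightarrow> nat" and q :: "'a poly"
    by (simp add: sign_def)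
  have det: "det M = (\<Sum>p\<in>?P. smult (signof p) (\<Prod>i=0..<n. M $$ (i, p i)))"
    by (simp add: det_def'[OF M] sign)
  show "degree (det M) \<le> (\<Sum>i<n. w i)"
    unfolding det by (intro degree_sum_le finite_permutations) (auto intro!: order_trans[OF degree_smult_le] prod)
  show "coeff (det M) (\<Sum>i<n. w i) = det (mat n n (\<lambda>(i, j). coeff (M $$ (i, j)) (w i)))"
    unfolding det by (subst det_def'[of _ n]) (auto simp: coeff_sum prod permutes_in_image intro!: sum.cong prod.cong)
qed

lemma resultant_eq_0_common_root:
  fixes p q :: "complex poly"
  assumes "resultant p q = 0" "p \<noteq> 0"
  obtains x where "poly p x = 0" "poly q x = 0"
proof -
  have "degree (gcd p q) \<noteq> 0"
    using assms(1) by (simp add: resultant_0_gcd)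
  then have "\<not> constant (poly (gcd p q))"
    by (simp add: constant_degree)
  then obtain x where "poly (gcd p q) x = 0"
    using fundamental_theorem_of_algebra by blast
  then have "[:-x, 1:] dvd gcd p q"
    by (simp add: poly_eq_0_iff_dvd)
  then have "[:-x, 1:] dvd p" "[:-x, 1:] dvd q"
    by (auto dest: dvd_trans)
  then show ?thesis
    using that by (simp add: poly_eq_0_iff_dvd)
qed

section \<open>Orders of vanishing along a curve\<close>

lemma order_power_mult:
  fixes p :: "'a :: idom poly"
  assumes "p \<noteq> 0"
  shows "order a (p ^ k) = k * order a p"
  using assms by (induction k) (simp_all add: order_mult order_1_eq_0)

text \<open>Split off the power of x from \<open>q\<close>. The cofactor composed with
  \<open>T\<close> does not vanish at 0 because \<open>T\<close> does, so only the power of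
  \<open>T\<close> contributes to the order.\<close>

lemma order_0_pcompose:
  fixes q T :: "'a :: idom poly"
  assumes "q \<noteq> 0" "T \<noteq> 0" "order 0 T > 0"
  shows "pcompose q T \<noteq> 0" "order 0 (pcompose q T) = order 0 q * order 0 T"
proof -
  obtain r where r: "q = [:- 0, 1:] ^ order 0 q * r" "\<not> [:- 0, 1:] dvd r"
    using order_decomp[OF assms(1)] by blast
  have "pcompose ([:0, 1:] ^ k) T = T ^ k" for k
    by (induction k) (simp_all add: pcompose_mult pcompose_pCons pcompose_1)
  then have eq: "pcompose q T = T ^ order 0 q * pcompose r T"
    by (subst r(1)) (simp add: pcompose_mult)
  have "poly T 0 = 0"
    using assms(3) by (simp add: order_root)
  then have r0: "poly (pcompose r T) 0 \<noteq> 0"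
    using r(2) by (simp add: poly_pcompose) (simp add: poly_eq_0_iff_dvd)
  then show nz: "pcompose q T \<noteq> 0"
    using assms(2) unfolding eq by auto
  from r0 have "order 0 (pcompose r T) = 0"
    by (simp add: order_root)
  then show "order 0 (pcompose q T) = order 0 q * order 0 T"
    using nz assms(2) unfolding eq by (simp add: order_mult order_power_mult)
qed

text \<open>A non-zero summand of least order cannot cancel: all other summands are divisible by a
  higher power of x - a.\<close>

lemma sum_eq_0_distinct_order:
  fixes u :: "'b \<Rightarrow> 'a :: idom poly"
  assumes "finite A" and sum: "sum u A = 0"
    and distinct: "\<And>i j. i \<in> A \<Longrightarrow> j \<in> A \<Longrightarrow> u i \<noteq> 0 \<Longrightarrow> u j \<noteq> 0 \<Longrightarrow>
      order a (u i) = order a (u j) \<Longrightarrow> i = j"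
    and "i \<in> A"
  shows "u i = 0"
proof (rule ccontr)
  assume "u i \<noteq> 0"
  let ?B = "{i \<in> A. u i \<noteq> 0}"
  have "finite ?B" "?B \<noteq> {}"
    using \<open>u i \<noteq> 0\<close> assms(1,4) by auto
  then obtain k where k: "k \<in> ?B" and min: "\<And>j. j \<in> ?B \<Longrightarrow> order a (u k) \<le> order a (u j)"
    using ex_is_arg_min_if_finite[of ?B "\<lambda>i. order a (u i)"] by (auto simp: is_arg_min_linorder)
  have "[:- a, 1:] ^ Suc (order a (u k)) dvd u j" if "j \<in> A - {k}" for j
  proof (cases "u j = 0")
    case False
    then have "order a (u k) \<noteq> order a (u j)"
      using distinct[of k j] k that by auto
    then have "Suc (order a (u k)) \<le> order a (u j)"
      using min[of j] that False by force
    then show ?thesis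
      unfolding order_divides by blast
  qed simp
  then have "[:- a, 1:] ^ Suc (order a (u k)) dvd sum u (A - {k})"
    by (rule dvd_sum)
  moreover have "u k = - sum u (A - {k})"
    using sum.remove[of A k u] assms(1) k sum by (simp add: eq_neg_iff_add_eq_0)
  ultimately have "[:- a, 1:] ^ Suc (order a (u k)) dvd u k"
    by (simp del: power_Suc)
  then show False
    using k order_2[of "u k" a] by blast
qed

text \<open>Expand the zero in powers of \<open>S\<close>. Modulo \<open>order 0 T\<close>, the
  order of the \<open>i\<close>-th term is \<open>i * order 0 S\<close>; by coprimality these
  residues differ for \<open>i < order 0 T\<close>, so a \<open>g\<close> of smaller degree would
  have every term zero.\<close>

lemma degree_ge_order_of_coprime:
  fixes g :: "'a :: idom poly poly"
  assumes S: "S \<noteq> 0" and T: "T \<noteq> 0" "order 0 T > 0"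
    and cop: "coprime (order 0 S) (order 0 T)"
    and "g \<noteq> 0" and zero: "poly (map_poly (\<lambda>q. pcompose q T) g) S = 0"
  shows "order 0 T \<le> degree g"
proof (rule ccontr)
  let ?b = "order 0 T"
  define u where "u i = pcompose (coeff g i) T * S ^ i" for i
  assume "\<not> ?thesis"
  then have deg: "degree g < ?b" by simp
  have ord: "order 0 (u i) = ?b * order 0 (coeff g i) + i * order 0 S" if "u i \<noteq> 0" for i
  proof -
    have "coeff g i \<noteq> 0" using that by (auto simp: u_def)
    then show ?thesis
      using that S T unfolding u_def by (simp add: order_mult order_power_mult order_0_pcompose)
  qed
  have "(\<Sum>i\<le>degree g. u i) = poly (map_poly (\<lambda>q. pcompose q T) g) S"
    using eval_poly_as_sum[of "\<lambda>q. pcompose q T" g S] by (simp add: eval_poly_def u_def mult.commute)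
  then have "u i = 0" if "i \<le> degree g" for i
  proof (rule sum_eq_0_distinct_order[where a = 0, rotated, OF trans[OF _ zero]])
    fix i j assume ij: "i \<in> {..degree g}" "j \<in> {..degree g}" "u i \<noteq> 0" "u j \<noteq> 0"
      and eq: "order 0 (u i) = order 0 (u j)"
    have "[order 0 S * i = order 0 S * j] (mod ?b)"
    proof -
      have "(?b * order 0 (coeff g i) + i * order 0 S) mod ?b = (?b * order 0 (coeff g j) + j * order 0 S) mod ?b"
        using eq ord ij by simp
      then show ?thesis by (simp add: cong_def mult.commute)
    qed
    then have "[i = j] (mod ?b)"
      using cop by (simp add: cong_mult_lcancel_nat)
    then show "i = j"
      using ij deg by (simp add: cong_def)
  qed (use that in auto)
  \<comment> \<open>Composition with \<open>T\<close> kills no non-zero polynomial, so the vanishing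
    of the top term contradicts \<open>g \<noteq> 0\<close>.\<close>
  from this[of "degree g"] have "pcompose (lead_coeff g) T = 0"
    using S by (simp add: u_def)
  then show False
    using order_0_pcompose(1)[of "lead_coeff g" T] T \<open>g \<noteq> 0\<close> by simp
qed

section \<open>A criterion for irreducibility\<close>

text \<open>Coefficients stay in the full type \<open>cpoly\<close>, an integral domain, so degrees
  add and leading coefficients multiply over factorisations.\<close>

definition as_poly :: "nat \<Rightarrow> cpoly \<Rightarrow> cpoly poly" where
  "as_poly i = cpoly_eval (\<lambda>c. [:cconst c:]) (\<lambda>j. if j = i then [:0, 1:] else [:cvar j:])"

lemma comm_ring_hom_const_poly: "comm_ring_hom (\<lambda>c::'a::comm_ring_1. [:c:])"
  by unfold_locales simp_all

lemma comm_ring_hom_const_cconst: "comm_ring_hom (\<lambda>c. [:cconst c:])"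
  by unfold_locales (simp_all add: cconst_add cconst_mult)

interpretation as_poly: comm_ring_hom "as_poly i"
  unfolding as_poly_def by (intro comm_ring_hom_cpoly_eval comm_ring_hom_const_cconst)

lemma as_poly_cconst [simp]: "as_poly i (cconst c) = [:cconst c:]"
  and as_poly_cvar: "as_poly i (cvar j) = (if j = i then [:0, 1:] else [:cvar j:])"
  by (simp_all add: as_poly_def comm_ring_hom_const_cconst)

lemma poly_as_poly: "poly (as_poly i p) (cvar i) = p"
  by (induction p rule: cpoly_induct) (simp_all add: as_poly_cvar as_poly.hom_add as_poly.hom_mult)

text \<open>This keeps leading coefficients inside the subring, where they serve as inverses up to a
  constant.\<close>

lemma coeff_as_poly_carrier:
  "p \<in> carrier (cpoly_ring I) \<Longrightarrow> coeff (as_poly i p) k \<in> carrier (cpoly_ring I)"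
proof (induction p arbitrary: k rule: cpoly_ring_induct)
  case (const c)
  then show ?case by (cases k) (auto simp: coeff_pCons)
next
  case (var j)
  then show ?case by (auto simp: as_poly_cvar coeff_pCons split: nat.split)
next
  case (mult p q)
  then show ?case by (auto simp: as_poly.hom_mult coeff_mult)
qed (auto simp: as_poly.hom_add)

lemma cpoly_ring_domain: "domain (cpoly_ring I)"
proof -
  interpret cring "cpoly_ring I" by (rule cpoly_ring_cring)
  show ?thesis by unfold_locales simp_all
qed

lemma cpoly_ring_UnitsI:
  assumes "p \<in> carrier (cpoly_ring I)" "q \<in> carrier (cpoly_ring I)" "p * q = cconst c" "c \<noteq> 0"
  shows "p \<in> Units (cpoly_ring I)"
proof -
  have "p * (cconst (1 / c) * q) = 1"
    using assms(3,4) by (simp only: mult.left_commute[of p] flip: cconst_mult) simp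
  moreover have "cconst (1 / c) * q \<in> carrier (cpoly_ring I)"
    using assms(2) by auto
  ultimately show ?thesis
    using assms(1) unfolding Units_def by (auto simp: mult.commute intro!: bexI[of _ "cconst (1 / c) * q"])
qed

text \<open>The constant leading coefficient lets factors keep their degree in
  \<open>\<sigma>\<close> when the other variables are specialised, and makes a factor free of
  \<open>\<sigma>\<close> a unit. Two factors of positive degree would each have degree at least
  \<open>order 0 T\<close>, together more than \<open>N\<close>.\<close>

lemma ring_irreducible_criterion:
  assumes V: "V \<in> carrier (cpoly_ring I)" and "\<sigma> \<noteq> \<tau>"
    and deg: "degree (as_poly \<sigma> V) = N" "N > 0"
    and lead: "lead_coeff (as_poly \<sigma> V) = cconst c" "c \<noteq> 0"
    and curve: "\<And>s t. cpoly_eval id (\<beta>(\<sigma> := s, \<tau> := t)) V = 0 \<Longrightarrow> \<exists>y. poly S y = s \<and> poly T y = t"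
    and S: "S \<noteq> 0" and T: "T \<noteq> 0" "order 0 T > 0"
    and cop: "coprime (order 0 S) (order 0 T)" and N: "N < 2 * order 0 T"
  shows "ring_irreducible\<^bsub>cpoly_ring I\<^esub> V"
proof -
  interpret R: domain "cpoly_ring I" by (rule cpoly_ring_domain)
  let ?e = "\<lambda>s t. cpoly_eval id (\<beta>(\<sigma> := s, \<tau> := t))"
  \<comment> \<open>All variables but \<open>\<tau>\<close> are fixed at \<open>\<beta>\<close>.
    Applied to the coefficients of \<open>as_poly \<sigma> p\<close>, this yields
    \<open>\<kappa> p\<close>, a polynomial in \<open>\<sigma>\<close> over complex polynomials in
    \<open>\<tau>\<close>.\<close>
  define \<rho> where "\<rho> = cpoly_eval (\<lambda>c. [:c:]) (\<lambda>i. if i = \<tau> then [:0, 1:] else [:\<beta> i:])"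
  interpret \<rho>: comm_ring_hom \<rho>
    unfolding \<rho>_def by (intro comm_ring_hom_cpoly_eval comm_ring_hom_const_poly)
  have id: "comm_ring_hom (id :: complex \<Rightarrow> complex)"
    by unfold_locales simp_all
  interpret e: comm_ring_hom "?e s t" for s t
    by (intro comm_ring_hom_cpoly_eval id)
  interpret map_\<rho>: map_poly_comm_ring_hom \<rho> ..
  have \<rho>_const: "\<rho> (cconst a) = [:a:]" for a
    by (simp add: \<rho>_def comm_ring_hom_const_poly)
  have \<rho>_var: "\<rho> (cvar i) = (if i = \<tau> then [:0, 1:] else [:\<beta> i:])" for i
    by (simp add: \<rho>_def comm_ring_hom_const_poly)
  define \<kappa> where "\<kappa> p = map_poly \<rho> (as_poly \<sigma> p)" for p
  have eval: "?e s t p = poly (map_poly (\<lambda>q. poly q t) (\<kappa> p)) s" for s t p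
  proof -
    interpret t: comm_ring_hom "\<lambda>q::complex poly. poly q t"
      by unfold_locales simp_all
    interpret map_t: map_poly_comm_ring_hom "\<lambda>q::complex poly. poly q t" ..
    show ?thesis
      using \<open>\<sigma> \<noteq> \<tau>\<close>
      by (induction p rule: cpoly_induct)
        (simp_all add: \<kappa>_def \<rho>_const \<rho>_var id as_poly_cvar e.hom_add e.hom_mult as_poly.hom_add
          as_poly.hom_mult map_\<rho>.hom_add map_\<rho>.hom_mult map_t.hom_add map_t.hom_mult \<rho>.map_poly_pCons_hom Polynomial.map_poly_pCons)
  qed

  have factor: "order 0 T \<le> degree (as_poly \<sigma> G)"
    if GH: "V = G * H" and "degree (as_poly \<sigma> G) > 0" for G H
  proof -
    \<comment> \<open>The image of the leading coefficient of \<open>G\<close> divides a non-zero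
      constant, hence is a constant \<open>\<gamma>\<close>; no value of \<open>\<tau>\<close> can
      then lower the degree.\<close>
    have "lead_coeff (as_poly \<sigma> G) * lead_coeff (as_poly \<sigma> H) = cconst c"
      using lead(1) unfolding GH as_poly.hom_mult by (simp add: lead_coeff_mult)
    then have "\<rho> (lead_coeff (as_poly \<sigma> G)) * \<rho> (lead_coeff (as_poly \<sigma> H)) = [:c:]"
      by (metis \<rho>.hom_mult \<rho>_const)
    then have "\<rho> (lead_coeff (as_poly \<sigma> G)) dvd 1"
      using \<open>c \<noteq> 0\<close> by (metis dvd_triv_left dvd_trans is_unit_triv)
    then obtain \<gamma> where \<gamma>: "\<rho> (lead_coeff (as_poly \<sigma> G)) = [:\<gamma>:]" "\<gamma> \<noteq> 0"
      unfolding is_unit_poly_iff by (auto simp: dvd_field_iff)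
    have lc: "coeff (\<kappa> G) (degree (as_poly \<sigma> G)) = [:\<gamma>:]"
      using \<gamma>(1) by (simp add: \<kappa>_def)
    have deg\<kappa>: "degree (\<kappa> G) = degree (as_poly \<sigma> G)"
    proof (rule antisym)
      show "degree (\<kappa> G) \<le> degree (as_poly \<sigma> G)"
        unfolding \<kappa>_def by (rule degree_map_poly_le)
      show "degree (as_poly \<sigma> G) \<le> degree (\<kappa> G)"
        using lc \<gamma>(2) by (intro le_degree) simp
    qed
    \<comment> \<open>For each \<open>t\<close> the specialised factor has a root \<open>s\<close>;
      \<open>V\<close> vanishes at that point, so \<open>curve\<close> supplies a parameter
      \<open>y\<close>.\<close>
    have curve_G: "\<exists>y. poly T y = t \<and> poly (map_poly (\<lambda>q. poly q t) (\<kappa> G)) (poly S y) = 0" for t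
    proof -
      have "coeff (map_poly (\<lambda>q. poly q t) (\<kappa> G)) (degree (as_poly \<sigma> G)) = \<gamma>"
        by (simp add: coeff_map_poly lc)
      then have "degree (map_poly (\<lambda>q. poly q t) (\<kappa> G)) > 0"
        using le_degree[of "map_poly (\<lambda>q. poly q t) (\<kappa> G)" "degree (as_poly \<sigma> G)"] \<gamma>(2) that(2) by simp
      then have "\<not> constant (poly (map_poly (\<lambda>q. poly q t) (\<kappa> G)))"
        by (simp add: constant_degree)
      then obtain s where s: "poly (map_poly (\<lambda>q. poly q t) (\<kappa> G)) s = 0"
        using fundamental_theorem_of_algebra by blast
      then have "?e s t V = 0"
        unfolding GH e.hom_mult by (simp add: eval)
      then show ?thesis
        using curve[of s t] s by auto
    qed
    define \<Phi> where "\<Phi> = poly (map_poly (\<lambda>q. pcompose q T) (\<kappa> G)) S"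
    have \<Phi>: "poly \<Phi> y = poly (map_poly (\<lambda>q. poly q (poly T y)) (\<kappa> G)) (poly S y)" for y
      unfolding \<Phi>_def
      by (simp add: map_poly_map_poly poly_pcompose o_def flip: poly_hom.poly_map_poly)
    \<comment> \<open>The roots of \<open>\<Phi>\<close> are mapped by \<open>T\<close> onto the
      whole complex plane, which is impossible for a finite set.\<close>
    have "poly T ` {y. poly \<Phi> y = 0} = UNIV"
      using curve_G unfolding \<Phi> by (auto simp: image_iff) metis
    then have "infinite {y. poly \<Phi> y = 0}"
      using finite_imageI[of "{y. poly \<Phi> y = 0}" "poly T"] by (metis infinite_UNIV_char_0)
    then have "\<Phi> = 0"
      using poly_roots_finite by blast
    then show ?thesis
      using degree_ge_order_of_coprime[OF S T cop, of "\<kappa> G"] that(2) unfolding \<Phi>_def deg\<kappa>[symmetric] by force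
  qed

  have degree_mult: "degree (as_poly \<sigma> G) + degree (as_poly \<sigma> H) = N"
    and lead_mult: "lead_coeff (as_poly \<sigma> G) * lead_coeff (as_poly \<sigma> H) = cconst c"
    if "V = G * H" for G H
  proof -
    have "as_poly \<sigma> G * as_poly \<sigma> H \<noteq> 0"
      using lead unfolding that as_poly.hom_mult by auto
    then show "degree (as_poly \<sigma> G) + degree (as_poly \<sigma> H) = N"
      using deg unfolding that as_poly.hom_mult by (simp add: degree_mult_eq)
    show "lead_coeff (as_poly \<sigma> G) * lead_coeff (as_poly \<sigma> H) = cconst c"
      using lead(1) unfolding that as_poly.hom_mult by (simp add: lead_coeff_mult)
  qed
  have unit: "G \<in> Units (cpoly_ring I)"
    if GH: "V = G * H" "G \<in> carrier (cpoly_ring I)" "H \<in> carrier (cpoly_ring I)"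
      and "degree (as_poly \<sigma> G) = 0" for G H
  proof -
    \<comment> \<open>A polynomial free of \<open>\<sigma>\<close> is its own leading coefficient,
      so it divides the constant \<open>cconst c\<close>.\<close>
    have "G = lead_coeff (as_poly \<sigma> G)"
      using that(4) poly_as_poly[of \<sigma> G] by (metis degree_0_id poly_const_conv)
    then have "G * lead_coeff (as_poly \<sigma> H) = cconst c"
      using lead_mult[OF GH(1)] by simp
    then show ?thesis
      using GH \<open>c \<noteq> 0\<close> by (intro cpoly_ring_UnitsI[of G I "lead_coeff (as_poly \<sigma> H)"] coeff_as_poly_carrier)
  qed
  show ?thesis
  proof (rule R.ring_irreducibleI)
    have "V \<noteq> 0" using deg by auto
    then show "V \<in> carrier (cpoly_ring I) - {\<zero>\<^bsub>cpoly_ring I\<^esub>}"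
      using V by simp
    show "V \<notin> Units (cpoly_ring I)"
    proof
      assume "V \<in> Units (cpoly_ring I)"
      then obtain W where "V * W = 1"
        by (auto simp: Units_def)
      then have "as_poly \<sigma> V * as_poly \<sigma> W = 1"
        by (metis as_poly.hom_mult as_poly.hom_one)
      then have "as_poly \<sigma> V dvd 1"
        by (metis dvd_triv_left)
      then show False
        using deg by (auto elim!: is_unit_polyE)
    qed
    fix G H assume G: "G \<in> carrier (cpoly_ring I)" and H: "H \<in> carrier (cpoly_ring I)"
      and "V = G \<otimes>\<^bsub>cpoly_ring I\<^esub> H"
    then have GH: "V = G * H" "V = H * G" by (simp_all add: mult.commute)
    show "G \<in> Units (cpoly_ring I) \<or> H \<in> Units (cpoly_ring I)"
    proof (rule ccontr)
      assume "\<not> ?thesis"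
      then have "degree (as_poly \<sigma> G) > 0" "degree (as_poly \<sigma> H) > 0"
        using unit[OF GH(1) G H] unit[OF GH(2) H G] by auto
      then show False
        using factor[OF GH(1)] factor[OF GH(2)] degree_mult[OF GH(1)] N by linarith
    qed
  qed
qed

section \<open>Resultants with the derivative\<close>

text \<open>A common form for all \<open>P_k\<close>: the scalars \<open>\<gamma>\<close> are the
  only difference, and \<open>\<gamma> j = 0\<close> removes the variable of index
  \<open>d - j\<close>.\<close>

definition coeff_poly :: "nat \<Rightarrow> (nat \<Rightarrow> complex) \<Rightarrow> cpoly poly" where
  "coeff_poly d \<gamma> = (\<Sum>j\<le>d. monom (cconst (\<gamma> j) * (if j = d then 1 else cvar (d - j))) j)"

lemma coeff_coeff_poly:
  "coeff (coeff_poly d \<gamma>) j = (if j = d then cconst (\<gamma> d) else if j < d then cconst (\<gamma> j) * cvar (d - j) else 0)"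
  by (simp add: coeff_poly_def coeff_sum)

lemma of_nat_cpoly: "(of_nat k :: cpoly) = cconst (of_nat k)"
  by (simp add: cconst_def)

lemma coeff_poly_shift_pderiv:
  assumes "r > 0"
  shows "coeff (poly_shift (r - 1) (pderiv p)) j = of_nat (j + r) * coeff p (j + r)"
  using assms by (simp add: coeff_poly_shift coeff_pderiv)

lemma order_0_binomial:
  fixes a b :: "'a :: idom"
  assumes "b \<noteq> 0"
  shows "monom a (Suc k) + monom b k \<noteq> 0" "order 0 (monom a (Suc k) + monom b k) = k"
proof -
  have eq: "monom a (Suc k) + monom b k = monom 1 k * [:b, a:]"
    by (rule poly_eqI) (auto simp: coeff_monom_mult coeff_pCons split: nat.splits)
  have "order 0 [:b, a:] = 0"
    using assms by (intro order_0I) simp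
  then show "monom a (Suc k) + monom b k \<noteq> 0" "order 0 (monom a (Suc k) + monom b k) = k"
    unfolding eq using assms by (simp_all add: order_mult order_0_monom del: mult_pCons_right)
qed

lemma as_poly_cconst_mult_cvar:
  "as_poly i (cconst c * cvar j) = (if j = i then [:0, cconst c:] else [:cconst c * cvar j:])"
  by (simp add: as_poly.hom_mult as_poly_cvar)

text \<open>\<open>\<gamma> 0\<close> and \<open>\<gamma> r\<close> carry the variables t and s. For
  \<open>r = 2\<close> and even \<open>d\<close> the exponents \<open>d - r\<close> and
  \<open>d\<close> are not coprime, whence the condition on \<open>\<gamma> (d - 1)\<close>. The
  scalar \<open>a\<close> absorbs a sign.\<close>

context
  fixes d r :: nat and \<gamma> :: "nat \<Rightarrow> complex" and I :: "nat set" and a :: complex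
  assumes r: "r = 1 \<or> r = 2" and d: "r < d"
    and nonzero: "\<gamma> 0 \<noteq> 0" "\<gamma> r \<noteq> 0" "\<gamma> d \<noteq> 0" "r = 2 \<Longrightarrow> even d \<Longrightarrow> \<gamma> (d - 1) \<noteq> 0"
    and I: "\<And>j. j < d \<Longrightarrow> \<gamma> j \<noteq> 0 \<Longrightarrow> d - j \<in> I"
    and a: "a \<noteq> 0"
begin

private definition F where "F = coeff_poly d \<gamma>"
text \<open>\<open>poly_shift\<close> discards the coefficients below exponent \<open>r - 1\<close>;
  where these vanish, \<open>E\<close> is the exact quotient of the derivative by that power of
  x.\<close>

private definition E where "E = poly_shift (r - 1) (pderiv F)"
private definition V where "V = cconst a * resultant F E"

private lemma r0: "r > 0" using r by auto

private lemma coeff_F: "coeff F j = (if j = d then cconst (\<gamma> d) else if j < d then cconst (\<gamma> j) * cvar (d - j) else 0)"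
  by (simp add: F_def coeff_coeff_poly)

private lemma coeff_E: "coeff E j = cconst (of_nat (j + r)) * coeff F (j + r)"
  unfolding E_def coeff_poly_shift_pderiv[OF r0] of_nat_cpoly by simp

private lemma degree_F: "degree F = d"
  by (rule antisym; intro degree_le le_degree) (auto simp: coeff_F nonzero)

private lemma degree_E: "degree E = d - r"
proof (rule antisym)
  show "degree E \<le> d - r"
    by (rule degree_le) (auto simp: coeff_E coeff_F)
  show "d - r \<le> degree E"
    by (rule le_degree) (use d r0 in \<open>auto simp: coeff_E coeff_F nonzero\<close>)
qed

private lemma coeff_F_carrier: "coeff F j \<in> carrier (cpoly_ring I)"
proof -
  have "cconst (\<gamma> j) * cvar (d - j) \<in> carrier (cpoly_ring I)" if "j < d"
    using I[OF that] by (cases "\<gamma> j = 0") auto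
  then show ?thesis
    by (auto simp: coeff_F)
qed

private lemma V_carrier: "V \<in> carrier (cpoly_ring I)"
proof -
  have "resultant F E \<in> carrier (cpoly_ring I)"
    unfolding resultant_def
    by (rule cpoly_ring_det[OF sylvester_carrier_mat])
      (auto simp: sylvester_index_mat coeff_E intro!: coeff_F_carrier)
  then show ?thesis
    unfolding V_def by auto
qed

text \<open>Adding \<open>-(x\<^sup>r/r) E\<close> to \<open>F\<close> removes the variable of index \<open>d - r\<close> from the first rows
  of the Sylvester matrix, so it is left only on the diagonal of the last \<open>d\<close> rows.\<close>

private lemma as_poly_V:
  shows "degree (as_poly (d - r) V) = d"
    and "\<exists>c. lead_coeff (as_poly (d - r) V) = cconst c \<and> c \<noteq> 0"
proof -
  let ?n = "d - r"
  define u where "u = monom (cconst (- 1 / of_nat r)) r"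
  define G where "G = F + u * E"
  \<comment> \<open>From exponent \<open>r\<close> on, x^r E multiplies the coefficient of exponent
    j by j, so in \<open>G\<close> it is scaled by 1 - j/r, which is zero exactly at
    \<open>j = r\<close>.\<close>
  define \<delta> where "\<delta> j = (if j < r then 1 else 1 - of_nat j / of_nat r) * \<gamma> j" for j
  define M where "M = map_mat (as_poly ?n) (sylvester_mat_sub d ?n G E)"
  \<comment> \<open>The rows of \<open>G\<close> are free of the variable and those of
    \<open>E\<close> are at most linear in it; there are \<open>d\<close> of the latter.\<close>
  define w :: "nat \<Rightarrow> nat" where "w i = (if i < ?n then 0 else 1)" for i
  define C where "C = mat (d + ?n) (d + ?n) (\<lambda>(i, j). coeff (M $$ (i, j)) (w i))"
  have coeff_G: "coeff G j = (if j = d then cconst (\<delta> d) else if j < d then cconst (\<delta> j) * cvar (d - j) else 0)" for j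
  proof (cases "j < r")
    case True
    then show ?thesis
      using d by (simp add: G_def u_def coeff_monom_mult coeff_F \<delta>_def)
  next
    case False
    then have "coeff G j = coeff F j + cconst (- 1 / of_nat r) * (cconst (of_nat j) * coeff F j)"
      by (simp add: G_def u_def coeff_monom_mult coeff_E)
    also have "\<dots> = cconst (1 + (- 1 / of_nat r) * of_nat j) * coeff F j"
      by (simp only: cconst_add cconst_mult cconst_1 distrib_right mult.assoc mult_1_left)
    finally have "coeff G j = cconst (1 - of_nat j / of_nat r) * coeff F j"
      by simp
    with False show ?thesis
      using d by (auto simp: coeff_F \<delta>_def cconst_mult mult.assoc)
  qed
  have \<delta>r: "\<delta> r = 0"
    using r0 by (simp add: \<delta>_def)
  have \<delta>d: "\<delta> d \<noteq> 0"
    using r0 d nonzero by (simp add: \<delta>_def)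
  have "resultant F E = resultant_sub d ?n F E"
    by (simp add: resultant_sub degree_F degree_E)
  also have "\<dots> = resultant_sub d ?n G E"
    unfolding G_def
    by (rule resultant_sub_add_mult[symmetric])
      (use degree_monom_le[of "cconst (- 1 / of_nat r)" r] d in \<open>simp_all add: degree_F degree_E u_def\<close>)
  finally have as_poly_res: "as_poly ?n (resultant F E) = det M"
    by (simp add: resultant_sub_def M_def as_poly.hom_det)
  have M: "M \<in> carrier_mat (d + ?n) (d + ?n)"
    by (simp add: M_def sylvester_mat_sub_carrier)
  have as_poly_G: "as_poly ?n (coeff G j) = [:coeff G j:]" for j
  proof (cases "j = r")
    case True
    then show ?thesis using d by (simp add: coeff_G \<delta>r)
  next
    case False
    then have "d - j = ?n \<longleftrightarrow> False" if "j < d"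
      using d that by auto
    then show ?thesis
      by (auto simp: coeff_G as_poly_cconst_mult_cvar)
  qed
  have as_poly_E: "degree (as_poly ?n (coeff E j)) \<le> 1"
    "coeff (as_poly ?n (coeff E j)) 1 = (if j = 0 then cconst (of_nat r * \<gamma> r) else 0)" for j
  proof -
    have eq: "coeff E j = (if j = ?n then cconst (of_nat d * \<gamma> d) else if j < ?n
        then cconst (of_nat (j + r) * \<gamma> (j + r)) * cvar (d - (j + r)) else 0)"
      using d by (auto simp: coeff_E coeff_F cconst_mult mult.assoc)
    show "degree (as_poly ?n (coeff E j)) \<le> 1"
      by (auto simp: eq as_poly_cconst_mult_cvar)
    show "coeff (as_poly ?n (coeff E j)) 1 = (if j = 0 then cconst (of_nat r * \<gamma> r) else 0)"
      using d r0 by (auto simp: eq as_poly_cconst_mult_cvar)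
  qed
  have M_index: "M $$ (i, j) = (if i < ?n then
       if i \<le> j \<and> j - i \<le> d then [:coeff G (d + i - j):] else 0
     else if i - ?n \<le> j \<and> j \<le> i then as_poly ?n (coeff E (i - j)) else 0)"
    if "i < d + ?n" "j < d + ?n" for i j
    using that by (simp add: M_def sylvester_mat_sub_index as_poly_G)
  have deg_M: "degree (M $$ (i, j)) \<le> w i" if "i < d + ?n" "j < d + ?n" for i j
    using that as_poly_E(1) by (simp add: M_index w_def)
  have "(\<Sum>i<d + ?n. w i) = (\<Sum>i\<in>{?n..<d + ?n}. 1)"
    by (rule sum.mono_neutral_cong_right) (auto simp: w_def)
  then have sum_w: "(\<Sum>i<d + ?n. w i) = d"
    by simp
  \<comment> \<open>In \<open>E\<close> the variable occurs only in the constant term, which sits on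
    the diagonal; the matrix of top coefficients is therefore upper triangular.\<close>
  have C_index: "C $$ (i, j) = (if i < ?n then
       if i \<le> j \<and> j - i \<le> d then coeff G (d + i - j) else 0
     else if i = j then cconst (of_nat r * \<gamma> r) else 0)"
    if "i < d + ?n" "j < d + ?n" for i j
    using that as_poly_E(2) by (auto simp: C_def M_index w_def)
  have C: "C \<in> carrier_mat (d + ?n) (d + ?n)"
    by (simp add: C_def)
  have "det C = prod_list (diag_mat C)"
    by (rule det_upper_triangular[OF _ C]) (use C in \<open>auto simp: upper_triangular_def C_index\<close>)
  also have "\<dots> = (\<Prod>i=0..<d + ?n. if i < ?n then cconst (\<delta> d) else cconst (of_nat r * \<gamma> r))"
    using C unfolding prod_list_diag_prod by (intro prod.cong) (auto simp: C_index coeff_G)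
  also have "\<dots> = cconst (\<Prod>i=0..<d + ?n. if i < ?n then \<delta> d else of_nat r * \<gamma> r)"
    by (simp add: cconst.hom_prod if_distrib)
  finally obtain c where c: "det C = cconst c" and "c \<noteq> 0"
    using \<delta>d nonzero r0 by force
  have res: "degree (det M) \<le> d" "coeff (det M) d = cconst c"
    using degree_coeff_det_le[OF M deg_M] unfolding sum_w by (simp_all add: c flip: C_def)
  have V: "as_poly ?n V = smult (cconst a) (det M)"
    by (simp add: V_def as_poly.hom_mult as_poly_res)
  have coeff_V: "coeff (as_poly ?n V) d = cconst (a * c)"
    by (simp add: V res cconst_mult)
  show deg_V: "degree (as_poly ?n V) = d"
  proof (rule antisym)
    show "degree (as_poly ?n V) \<le> d"
      unfolding V using degree_smult_le res(1) by (rule order_trans)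
    show "d \<le> degree (as_poly ?n V)"
      using coeff_V a \<open>c \<noteq> 0\<close> by (intro le_degree) simp
  qed
  show "\<exists>c. lead_coeff (as_poly ?n V) = cconst c \<and> c \<noteq> 0"
    unfolding deg_V coeff_V using a \<open>c \<noteq> 0\<close> by (intro exI[of _ "a * c"]) simp
qed

text \<open>All coefficients except those of indices \<open>0\<close>, \<open>r\<close>, \<open>d\<close> are specialised to \<open>0\<close>, which gives
  a monomial curve with exponents \<open>d - r\<close> and \<open>d\<close>. When these exponents are not coprime, the
  coefficient of index \<open>d - 1\<close> is kept as well, which lowers both orders at \<open>0\<close> by one.\<close>

private lemma V_irreducible: "ring_irreducible\<^bsub>cpoly_ring I\<^esub> V"
proof -
  define \<epsilon> where "\<epsilon> \<longleftrightarrow> r = 2 \<and> even d"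
  define \<beta> :: "nat \<Rightarrow> complex" where "\<beta> i = (if i = 1 \<and> \<epsilon> then 1 else 0)" for i
  define g where "g = (if \<epsilon> then \<gamma> (d - 1) else 0)"
  \<comment> \<open>\<open>S\<close> solves E(y) = 0 for s. \<open>T\<close> solves F(y) - (y^r/r)
    E(y) = 0 for t, an equation from which s has disappeared.\<close>
  define S where "S = smult (- 1 / (of_nat r * \<gamma> r))
    (monom (of_nat d * \<gamma> d) (d - r) + monom (of_nat (d - 1) * g) (d - 1 - r))"
  define T where "T = smult (- 1 / \<gamma> 0)
    (monom ((1 - of_nat d / of_nat r) * \<gamma> d) d + monom ((1 - of_nat (d - 1) / of_nat r) * g) (d - 1))"
  have id: "comm_ring_hom (id :: complex \<Rightarrow> complex)"
    by unfold_locales simp_all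
  have \<epsilon>: "d \<ge> 4" "r = 2" if \<epsilon>
    using that d by (auto simp: \<epsilon>_def elim!: evenE)
  have curve: "\<exists>y. poly S y = s \<and> poly T y = t"
    if "cpoly_eval id (\<beta>(d - r := s, d := t)) V = 0" for s t
  proof -
    let ?e = "cpoly_eval id (\<beta>(d - r := s, d := t))"
    interpret e: comm_ring_hom ?e
      by (intro comm_ring_hom_cpoly_eval id)
    have coeff_eF: "?e (coeff F j) = (if j = d then \<gamma> d else if j = d - 1 \<and> \<epsilon> then g
      else if j = r then \<gamma> r * s else if j = 0 then \<gamma> 0 * t else 0)" for j
    proof -
      have "?e (coeff F j) = (if j = d then \<gamma> d else if j < d
          then \<gamma> j * (\<beta>(d - r := s, d := t)) (d - j) else 0)"
        by (simp add: coeff_F id e.hom_mult)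
      moreover have "(\<beta>(d - r := s, d := t)) (d - j) =
          (if j = 0 then t else if j = r then s else if j = d - 1 \<and> \<epsilon> then 1 else 0)" if "j < d"
        using that d r0 by (auto simp: \<beta>_def)
      ultimately have eq: "?e (coeff F j) = (if j = d then \<gamma> d else if j < d then \<gamma> j *
          (if j = 0 then t else if j = r then s else if j = d - 1 \<and> \<epsilon> then 1 else 0) else 0)"
        by simp
      show ?thesis
      proof (cases \<epsilon>)
        case True
        then have "d \<ge> 4" "r = 2" by (rule \<epsilon>)+
        \<comment> \<open>With \<open>d \<ge> 4\<close> the exponents 0, \<open>r\<close>,
          \<open>d - 1\<close> and \<open>d\<close> are distinct, so the four surviving coefficients
          do not interfere.\<close>
        then have "d - 1 \<noteq> r" "d - 1 \<noteq> 0" "d - 1 < d" "d - 1 \<noteq> d" by linarith+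
        then show ?thesis
          unfolding eq using True d r0 by (auto simp only: g_def if_True mult_1_right mult_zero_right split: if_split)
      next
        case False
        then show ?thesis
          unfolding eq using d r0 by auto
      qed
    qed
    have coeff_eE: "?e (coeff E j) = of_nat (j + r) * ?e (coeff F (j + r))" for j
      by (simp add: coeff_E id e.hom_mult)
    have eF: "map_poly ?e F = monom (\<gamma> d) d + monom g (d - 1) + monom (\<gamma> r * s) r + monom (\<gamma> 0 * t) 0"
      by (rule poly_eqI) (use d r0 \<epsilon> in \<open>auto simp: coeff_eF g_def\<close>)
    have eE: "map_poly ?e E = monom (of_nat d * \<gamma> d) (d - r) + monom (of_nat (d - 1) * g) (d - 1 - r)
        + monom (of_nat r * \<gamma> r * s) 0"
    proof (rule poly_eqI)
      fix j
      show "coeff (map_poly ?e E) j = coeff (monom (of_nat d * \<gamma> d) (d - r) +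
          monom (of_nat (d - 1) * g) (d - 1 - r) + monom (of_nat r * \<gamma> r * s) 0) j"
      proof (cases \<epsilon>)
        case True
        then obtain m where m: "d = m + 4" and r2: "r = 2"
          using \<epsilon> by (metis add.commute le_Suc_ex)
        have "j + r = d \<longleftrightarrow> d - r = j" "j + r = d - 1 \<longleftrightarrow> d - 1 - r = j" "j + r = r \<longleftrightarrow> 0 = j" "j + r \<noteq> 0"
          "d - r \<noteq> d - 1 - r" "d - r \<noteq> 0" "d - 1 - r \<noteq> 0"
          unfolding m r2 by auto
        then show ?thesis
          using True unfolding e.coeff_map_poly_hom coeff_eE coeff_eF coeff_add coeff_monom
          by (smt (verit, best) add_0_left add_0_right mult.assoc mult_zero_right)
      next
        case False
        have "j + r = d \<longleftrightarrow> d - r = j" "j + r = r \<longleftrightarrow> 0 = j" "j + r \<noteq> 0" "d - r \<noteq> 0" "g = 0"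
          using d r0 False by (auto simp: g_def)
        then show ?thesis
          using False unfolding e.coeff_map_poly_hom coeff_eE coeff_eF coeff_add coeff_monom
          by (smt (verit, best) add_0_left add_0_right mult.assoc mult_zero_right)
      qed
    qed
    \<comment> \<open>The leading coefficients are non-zero constants, so specialisation preserves
      both degrees and commutes with the resultant.\<close>
    have "degree (map_poly ?e F) = degree F"
      by (rule antisym[OF degree_map_poly_le], rule le_degree) (simp add: degree_F coeff_eF nonzero)
    moreover have "degree (map_poly ?e E) = degree E"
      by (rule antisym[OF degree_map_poly_le], rule le_degree)
        (use d in \<open>simp add: degree_E coeff_eE coeff_eF nonzero\<close>)
    ultimately have "resultant (map_poly ?e F) (map_poly ?e E) = ?e (resultant F E)"
      by (rule e.resultant_map_poly)
    also have "\<dots> = 0"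
      using that a by (simp add: V_def e.hom_mult id)
    finally have "resultant (map_poly ?e F) (map_poly ?e E) = 0" .
    moreover have "coeff (map_poly ?e F) d \<noteq> 0"
      by (simp add: coeff_eF nonzero)
    then have "map_poly ?e F \<noteq> 0"
      by (metis coeff_0)
    ultimately obtain y where "poly (map_poly ?e F) y = 0" "poly (map_poly ?e E) y = 0"
      by (rule resultant_eq_0_common_root)
    then have F0: "\<gamma> d * y ^ d + g * y ^ (d - 1) + \<gamma> r * s * y ^ r + \<gamma> 0 * t = 0"
      and E0: "of_nat d * \<gamma> d * y ^ (d - r) + of_nat (d - 1) * g * y ^ (d - 1 - r) + of_nat r * \<gamma> r * s = 0"
      unfolding eF eE by (simp_all add: poly_monom)
    have "poly S y = s"
    proof -
      have "of_nat d * \<gamma> d * y ^ (d - r) + of_nat (d - 1) * g * y ^ (d - 1 - r) = - (of_nat r * \<gamma> r * s)"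
        using E0 by (simp only: eq_neg_iff_add_eq_0)
      then show ?thesis
        using nonzero r0 by (simp only: S_def poly_smult poly_add poly_monom) simp
    qed
    moreover have "poly T y = t"
    proof -
      have "y ^ (d - r) * y ^ r = y ^ d"
        using d by (simp flip: power_add)
      moreover have "d - 1 - r + r = d - 1" if \<epsilon>
        using \<epsilon>[OF that] by simp
      then have "g * (y ^ (d - 1 - r) * y ^ r) = g * y ^ (d - 1)"
        by (auto simp only: g_def power_add[symmetric] mult_zero_left split: if_split)
      ultimately have "of_nat d * \<gamma> d * y ^ d + of_nat (d - 1) * g * y ^ (d - 1) + of_nat r * \<gamma> r * s * y ^ r
        = y ^ r * (of_nat d * \<gamma> d * y ^ (d - r) + of_nat (d - 1) * g * y ^ (d - 1 - r) + of_nat r * \<gamma> r * s)"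
        by (auto simp: algebra_simps)
      then have "of_nat d * \<gamma> d * y ^ d + of_nat (d - 1) * g * y ^ (d - 1) + of_nat r * \<gamma> r * s * y ^ r = 0"
        by (simp only: E0 mult_zero_right)
      then have s: "\<gamma> r * s * y ^ r = - (of_nat d / of_nat r * \<gamma> d * y ^ d + of_nat (d - 1) / of_nat r * g * y ^ (d - 1))"
        using r0 by (simp add: field_simps eq_neg_iff_add_eq_0)
      have "\<gamma> 0 * t = - (\<gamma> d * y ^ d + g * y ^ (d - 1) + \<gamma> r * s * y ^ r)"
        using F0 by (simp only: eq_neg_iff_add_eq_0 add.commute[of "\<gamma> 0 * t"])
      also have "\<dots> = - ((1 - of_nat d / of_nat r) * \<gamma> d * y ^ d + (1 - of_nat (d - 1) / of_nat r) * g * y ^ (d - 1))"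
        unfolding s by (simp add: algebra_simps)
      finally have t: "(1 - of_nat d / of_nat r) * \<gamma> d * y ^ d + (1 - of_nat (d - 1) / of_nat r) * g * y ^ (d - 1)
          = - (\<gamma> 0 * t)"
        by simp
      then show ?thesis
        using nonzero by (simp only: T_def poly_smult poly_add poly_monom t) simp
    qed
    ultimately show ?thesis by blast
  qed
  have orders: "S \<noteq> 0 \<and> T \<noteq> 0 \<and> coprime (order 0 S) (order 0 T) \<and> order 0 T > 0 \<and> d < 2 * order 0 T"
  proof (cases \<epsilon>)
    case True
    \<comment> \<open>The lowest terms come from \<open>g\<close> and have exponents
      \<open>d - 3\<close> and \<open>d - 1\<close>: odd numbers differing by 2, hence
      coprime.\<close>
    have d4: "d \<ge> 4" and r2: "r = 2" using True by (rule \<epsilon>)+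
    have "g \<noteq> 0" using True nonzero by (simp add: g_def \<epsilon>_def)
    have "d - r = Suc (d - 1 - r)" "d = Suc (d - 1)" using d4 r2 by auto
    have bS: "of_nat (d - 1) * g \<noteq> 0"
      using d4 \<open>g \<noteq> 0\<close> by simp
    have bT: "(1 - of_nat (d - 1) / of_nat r) * g \<noteq> 0"
    proof -
      have "(of_nat (d - 1) :: complex) \<noteq> of_nat r"
        unfolding of_nat_eq_iff using d4 r2 by simp
      then show ?thesis
        using \<open>g \<noteq> 0\<close> r0 by simp
    qed
    have "S \<noteq> 0" "order 0 S = d - 3"
      using order_0_binomial[OF bS, of "of_nat d * \<gamma> d" "d - 1 - r"] d4 nonzero
      unfolding S_def \<open>d - r = _\<close>[symmetric] by (simp_all add: r2 order_smult)
    moreover have "T \<noteq> 0" "order 0 T = d - 1"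
      using order_0_binomial[OF bT, of "(1 - of_nat d / of_nat r) * \<gamma> d" "d - 1"] nonzero
      unfolding T_def \<open>d = _\<close>[symmetric] by (simp_all add: order_smult)
    moreover have "coprime (d - 3) (d - 1)"
    proof -
      have "gcd (d - 3) (d - 1) dvd (d - 1) - (d - 3)"
        by (rule dvd_diff_nat[OF gcd_dvd2 gcd_dvd1])
      then have "gcd (d - 3) (d - 1) dvd 2"
        using d4 by simp
      moreover have "odd (d - 1)"
        using True d4 by (simp add: \<epsilon>_def)
      then have "odd (gcd (d - 3) (d - 1))"
        using gcd_dvd2 dvd_trans by blast
      ultimately show ?thesis
        by (metis coprime_iff_gcd_eq_1 dvd_refl two_is_prime_nat prime_nat_iff)
    qed
    ultimately show ?thesis using d4 by auto
  next
    case False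
    \<comment> \<open>Both curves are monomials, of exponents \<open>d - r\<close> and
      \<open>d\<close>, whose gcd divides \<open>r\<close>; if \<open>r = 2\<close>, then
      \<open>d\<close> is odd.\<close>
    then have g: "g = 0" by (simp add: g_def)
    have "S \<noteq> 0" "order 0 S = d - r"
      using d nonzero r0 by (auto simp: S_def g order_smult order_0_monom monom_eq_0_iff)
    moreover have "(1 - of_nat d / of_nat r :: complex) \<noteq> 0"
      using d r0 by simp
    then have "T \<noteq> 0" "order 0 T = d"
      using nonzero by (auto simp: T_def g order_smult order_0_monom monom_eq_0_iff)
    moreover have "coprime (d - r) d"
    proof -
      have "gcd (d - r) d dvd d - (d - r)"
        by (rule dvd_diff_nat[OF gcd_dvd2 gcd_dvd1])
      then have dvd: "gcd (d - r) d dvd r"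
        using d by simp
      show ?thesis
      proof (cases "r = 1")
        case True
        then show ?thesis using dvd by (simp add: coprime_iff_gcd_eq_1)
      next
        case r2: False
        then have "r = 2" "odd d" using r False by (auto simp: \<epsilon>_def)
        then have "odd (gcd (d - r) d)" by auto
        then show ?thesis
          using dvd \<open>r = 2\<close> by (metis coprime_iff_gcd_eq_1 dvd_refl two_is_prime_nat prime_nat_iff)
      qed
    qed
    ultimately show ?thesis using d by auto
  qed
  obtain c where "lead_coeff (as_poly (d - r) V) = cconst c" "c \<noteq> 0"
    using as_poly_V(2) by blast
  then show ?thesis
    using d r0 orders
    by (intro ring_irreducible_criterion[OF V_carrier _ as_poly_V(1) _ _ _ curve]) auto
qed

lemma resultant_shift_pderiv_irreducible:
  "cconst a * resultant (coeff_poly d \<gamma>) (poly_shift (r - 1) (pderiv (coeff_poly d \<gamma>))) \<in> carrier (cpoly_ring I)"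
  "ring_irreducible\<^bsub>cpoly_ring I\<^esub>
    (cconst a * resultant (coeff_poly d \<gamma>) (poly_shift (r - 1) (pderiv (coeff_poly d \<gamma>))))"
  using V_carrier V_irreducible by (simp_all add: V_def E_def F_def)

end

section \<open>Application to the polynomials \<open>P_k\<close>\<close>

lemma coeff_general_poly:
  "coeff (general_poly n) j = (if j = n then 1 else if j < n then cvar (n - j) else 0)"
proof -
  have "coeff (general_poly n) j = (if n = j then 1 else 0) + (\<Sum>i=1..n. if n - i = j then cvar i else 0)"
    by (simp add: general_poly_def coeff_sum)
  also have "(\<Sum>i=1..n. if n - i = j then cvar i else 0) = (\<Sum>i=1..n. if i = n - j \<and> j < n then cvar i else 0)"
    by (rule sum.cong) auto
  also have "\<dots> = (if j < n then cvar (n - j) else 0)"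
    by (cases "j < n") (auto simp: sum.delta)
  finally show ?thesis by simp
qed

text \<open>Differentiation lowers degree and exponent together, so the index \<open>d - j\<close>
  of the variable persists with \<open>d = n - 1\<close>; the variable of index \<open>n\<close>
  drops out.\<close>

lemma P_k_self:
  assumes "n > 0"
  shows "P_k n n = coeff_poly (n - 1) (\<lambda>j. of_nat (j + 1))"
proof (rule poly_eqI)
  fix j
  show "coeff (P_k n n) j = coeff (coeff_poly (n - 1) (\<lambda>j. of_nat (j + 1))) j"
    using assms unfolding P_k_def coeff_coeff_poly
    by (auto simp: coeff_pderiv coeff_general_poly simp flip: of_nat_cpoly of_nat_Suc)
qed

text \<open>The operator x d/dx multiplies the coefficient of x^j by j. The resulting scalar
  vanishes at \<open>j = n - k\<close>, which removes the variable of index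
  \<open>k\<close>.\<close>

lemma P_k_less:
  assumes "k < n"
  shows "P_k n k = coeff_poly n (\<lambda>j. 1 - of_nat j / of_nat (n - k))"
proof (rule poly_eqI)
  fix j
  have "coeff (P_k n k) j = cconst (1 - of_nat j / of_nat (n - k)) * coeff (general_poly n) j"
    using assms by (cases j) (simp_all add: P_k_def coeff_pderiv of_nat_cpoly cconst.hom_minus
        algebra_simps divide_inverse flip: cconst_mult of_nat_Suc)
  then show "coeff (P_k n k) j = coeff (coeff_poly n (\<lambda>j. 1 - of_nat j / of_nat (n - k))) j"
    by (simp add: coeff_general_poly coeff_coeff_poly)
qed

theorem theorem11:
  fixes n :: nat
  assumes "n \<ge> 3"
  shows "(\<forall>k \<in> {1..n}. k \<noteq> n - 1 \<longrightarrow>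
            res_deriv n k \<in> carrier (coeff_ring n k) \<and>
            ring_irreducible\<^bsub>coeff_ring n k\<^esub> (res_deriv n k))
       \<and> (\<exists>V \<in> carrier (coeff_ring n (n - 1)).
            ring_irreducible\<^bsub>coeff_ring n (n - 1)\<^esub> V \<and>
            res_deriv n (n - 1) = cvar n * V)"
proof (intro conjI ballI impI)
  fix k assume k: "k \<in> {1..n}" "k \<noteq> n - 1"
  \<comment> \<open>The form \<open>cconst 1 * _\<close>, like \<open>1 - 1\<close> below, matches
    the general result with \<open>a = 1\<close> and \<open>r = 1\<close>.\<close>
  have "cconst 1 * res_deriv n k \<in> carrier (coeff_ring n k) \<and>
    ring_irreducible\<^bsub>coeff_ring n k\<^esub> (cconst 1 * res_deriv n k)"
  proof (cases "k = n")
    case True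
    then have eq: "res_deriv n k = resultant (coeff_poly (n - 1) (\<lambda>j. of_nat (j + 1)))
        (poly_shift (1 - 1) (pderiv (coeff_poly (n - 1) (\<lambda>j. of_nat (j + 1)))))"
      using assms by (simp add: res_deriv_def P_k_self)
    show ?thesis
      unfolding eq
      by (intro conjI resultant_shift_pderiv_irreducible) (use assms True in \<open>auto simp del: of_nat_Suc\<close>)
  next
    case False
    then have kn: "k < n" using k by auto
    then have eq: "res_deriv n k = resultant (coeff_poly n (\<lambda>j. 1 - of_nat j / of_nat (n - k)))
        (poly_shift (1 - 1) (pderiv (coeff_poly n (\<lambda>j. 1 - of_nat j / of_nat (n - k)))))"
      by (simp add: res_deriv_def P_k_less)
    \<comment> \<open>Taking \<open>r = 1\<close> requires a non-zero scalar at
      \<open>j = 1\<close>; the only zero is at \<open>n - k\<close>, so this is where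
      \<open>k \<noteq> n - 1\<close> enters.\<close>
    have zero_iff: "(1 - of_nat j / of_nat (n - k) :: complex) = 0 \<longleftrightarrow> j = n - k" for j
      using kn of_nat_eq_iff[of "n - k" j, where 'a = complex] by auto
    show ?thesis
      unfolding eq
      by (intro conjI resultant_shift_pderiv_irreducible) (use assms kn k in \<open>auto simp only: zero_iff, auto\<close>)
  qed
  then show "res_deriv n k \<in> carrier (coeff_ring n k)"
    "ring_irreducible\<^bsub>coeff_ring n k\<^esub> (res_deriv n k)" by simp_all
next
  \<comment> \<open>For \<open>k = n - 1\<close> the scalar at \<open>j = 1\<close> vanishes, so the
    role of s passes to the coefficient of x^2, that is \<open>r = 2\<close>.\<close>
  let ?\<gamma> = "\<lambda>j. 1 - of_nat j :: complex"
  let ?F = "coeff_poly n ?\<gamma>"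
  let ?E = "poly_shift 1 (pderiv ?F)"
  let ?V = "cconst ((- 1) ^ n) * resultant ?F ?E"
  have F: "P_k n (n - 1) = ?F"
    using P_k_less[of "n - 1" n] assms by simp
  have nz: "?\<gamma> n \<noteq> 0" "?\<gamma> (n - 1) \<noteq> 0"
    using assms of_nat_eq_iff[of 1 n, where 'a = complex] of_nat_eq_iff[of 1 "n - 1", where 'a = complex]
    by auto
  have shift2: "?E = poly_shift (2 - 1) (pderiv ?F)"
    by simp
  have "?V \<in> carrier (coeff_ring n (n - 1)) \<and> ring_irreducible\<^bsub>coeff_ring n (n - 1)\<^esub> ?V"
    unfolding shift2
    by (intro conjI resultant_shift_pderiv_irreducible) (use assms nz in \<open>auto simp: not_less\<close>)
  moreover have "res_deriv n (n - 1) = cvar n * ?V"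
  proof -
    have coeff_F: "coeff ?F j = cconst (?\<gamma> j) * (if j = n then 1 else if j < n then cvar (n - j) else 0)" for j
      by (simp add: coeff_coeff_poly)
    have dF: "degree ?F = n"
      by (rule antisym; intro degree_le le_degree) (use nz in \<open>auto simp: coeff_F\<close>)
    have coeff_dF: "coeff (pderiv ?F) j = cconst (of_nat (Suc j)) * coeff ?F (Suc j)" for j
      by (simp only: coeff_pderiv of_nat_cpoly)
    \<comment> \<open>\<open>?F\<close> has no linear term, so its derivative is divisible by
      x.\<close>
    have shift: "pderiv ?F = pCons 0 ?E"
      by (rule poly_eqI) (auto simp: coeff_dF coeff_F coeff_poly_shift coeff_pCons split: nat.split)
    have dE: "degree ?E = n - 2"
    proof (rule antisym)
      show "degree ?E \<le> n - 2"
        by (rule degree_le) (auto simp: coeff_poly_shift coeff_dF coeff_F)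
      show "n - 2 \<le> degree ?E"
        using assms nz
        by (intro le_degree) (simp add: coeff_poly_shift coeff_dF coeff_F Suc_diff_Suc numeral_2_eq_2 del: of_nat_Suc)
    qed
    have "?E \<noteq> 0"
      using dE assms by auto
    then have dP: "degree (pderiv ?F) = Suc (n - 2)"
      using dE by (subst shift) (simp only: degree_pCons_eq simp_thms)
    have "res_deriv n (n - 1) = resultant_sub n (Suc (n - 2)) ?F (pCons 0 ?E)"
      unfolding res_deriv_def F resultant_sub dF dP by (simp only: shift[symmetric])
    also have "\<dots> = (- 1) ^ n * coeff ?F 0 * resultant_sub n (n - 2) ?F ?E"
      by (rule resultant_sub_pCons_0)
    also have "resultant_sub n (n - 2) ?F ?E = resultant ?F ?E"
      by (simp only: resultant_sub dF dE)
    \<comment> \<open>The constant term of \<open>?F\<close> supplies the factor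
      \<open>cvar n\<close>, and the sign goes into \<open>?V\<close>.\<close>
    also have "(- 1) ^ n * coeff ?F 0 * resultant ?F ?E = cvar n * ?V"
      using assms by (simp add: coeff_F cconst.hom_power cconst.hom_uminus mult_ac)
    finally show ?thesis .
  qed
  ultimately show "\<exists>V \<in> carrier (coeff_ring n (n - 1)).
      ring_irreducible\<^bsub>coeff_ring n (n - 1)\<^esub> V \<and> res_deriv n (n - 1) = cvar n * V"
    by blast
qed

end
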